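(* Let $n>2$ be a real number, let $R>0$, put $q=\frac{n+2}{n-2}$, and let $a\in C^3[0,R]$ be a real-valued function such that (i) $a(0)=0$; (ii) $a'(x)>0$ for all $x\in(0,R)$; (iii) there exists $\omega\ge 0$ such that $a''(x)\ge \omega\, a(x)$ for all $x\in(0,R)$. Let $\lambda\in\mathbb{R}$ satisfy $$\lambda\le \mu^*(n,R):=\frac{n-2}{4}\,\inf_{0<x<R}\left\{(n-1)\frac{a''(x)}{a(x)}+\frac{a'''(x)}{a'(x)}\right\}.$$ Then the boundary value problem $$\begin{cases}-u''(x)-(n-1)\dfrac{a'(x)}{a(x)}u'(x)=\lambda u(x)+|u(x)|^{q-1}u(x),\\ u'(0)=u(R)=0,\end{cases}$$ has no non-trivial solution $u\in C^2[0,R]$.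
   Context: A solution is a real-valued function $u\in C^2[0,R]$ satisfying the differential equation for $x\in(0,R)$ together with the boundary conditions $u'(0)=0$ and $u(R)=0$; it is non-trivial if it is not identically zero. The infimum is taken in the extended reals (if it equals $-\infty$, the condition on $\lambda$ is never satisfied). *)

theory Defs
  imports "HOL-Analysis.Analysis"
begin

text \<open>
  Functions on [0,R] are represented by total functions on the reals of which only the values on
  [0,R] matter. Derivatives are therefore taken within the interval: they are one-sided at the
  end points, and independent of how the function is extended outside.
\<close>

definition ivl_deriv :: "real \<Rightarrow> nat \<Rightarrow> (real \<Rightarrow> real) \<Rightarrow> real \<Rightarrow> real" where
  "ivl_deriv R k f = ((\<lambda>g x. vector_derivative g (at x within {0..R})) ^^ k) f"

definition C_ivl :: "nat \<Rightarrow> real \<Rightarrow> (real \<Rightarrow> real) \<Rightarrow> bool" where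
  "C_ivl k R f \<longleftrightarrow>
     (\<forall>j<k. ivl_deriv R j f differentiable_on {0..R}) \<and>
     (\<forall>j\<le>k. continuous_on {0..R} (ivl_deriv R j f))"

lemma ivl_deriv_0 [simp]: "ivl_deriv R 0 f = f"
  by (simp add: ivl_deriv_def)

lemma ivl_deriv_Suc_eq:
  assumes "0 < R" "x \<in> {0..R}"
    and "(ivl_deriv R k f has_real_derivative D) (at x within {0..R})"
  shows "ivl_deriv R (Suc k) f x = D"
  using vector_derivative_within_closed_interval[of 0 R x "ivl_deriv R k f" D] assms
  by (simp add: ivl_deriv_def has_real_derivative_iff_has_vector_derivative)

lemma C_ivl_has_derivative:
  assumes "C_ivl k R f" "j < k" "x \<in> {0..R}"
  shows "(ivl_deriv R j f has_real_derivative ivl_deriv R (Suc j) f x) (at x within {0..R})"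
proof -
  have "ivl_deriv R j f differentiable (at x within {0..R})"
    using assms by (auto simp: C_ivl_def differentiable_on_def)
  then show ?thesis
    by (simp add: ivl_deriv_def has_real_derivative_iff_has_vector_derivative
        vector_derivative_works)
qed

definition mu_star :: "(real \<Rightarrow> real) \<Rightarrow> real \<Rightarrow> real \<Rightarrow> ereal" where
  "mu_star a n R =
     ereal ((n - 2) / 4) *
     (INF x\<in>{0<..<R}. ereal ((n - 1) * (ivl_deriv R 2 a x / a x)
                              + ivl_deriv R 3 a x / ivl_deriv R 1 a x))"

text \<open>With \<open>powr\<close> the factor \<open>\<bar>u x\<bar> powr (q - 1)\<close> is 0 where \<open>u x = 0\<close>,
  so the nonlinearity vanishes there, as it should.\<close>

definition is_solution ::
  "(real \<Rightarrow> real) \<Rightarrow> real \<Rightarrow> real \<Rightarrow> real \<Rightarrow> real \<Rightarrow> (real \<Rightarrow> real) \<Rightarrow> bool" where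
  "is_solution a n R q lam u \<longleftrightarrow>
     C_ivl 2 R u \<and>
     (\<forall>x\<in>{0<..<R}.
        - ivl_deriv R 2 u x - (n - 1) * (ivl_deriv R 1 a x / a x) * ivl_deriv R 1 u x
        = lam * u x + \<bar>u x\<bar> powr (q - 1) * u x) \<and>
     ivl_deriv R 1 u 0 = 0 \<and> u R = 0"

end

theory Submission
  imports Defs
begin

text \<open>
  Multiplying the equation by \<open>a\<^sup>n u'\<close> and by \<open>(n - 2)/2 * a\<^sup>n\<^sup>-\<^sup>1 a' u\<close> and adding gives a Pohozaev
  identity in which the critical exponent makes the nonlinear term cancel: the functional
  \<open>P = pohozaev a n R q lam u\<close> satisfies \<open>P' = a\<^sup>n\<^sup>-\<^sup>1 a' u\<^sup>2 (lam - M)\<close>, where \<open>M\<close> is the function whose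
  infimum is \<open>\<mu>\<^sup>*\<close>. Hence \<open>P\<close> is nonincreasing from \<open>P 0 = 0\<close>, whereas \<open>P R = a(R)\<^sup>n u'(R)\<^sup>2 / 2\<close>. So
  \<open>u' R = 0 = u R\<close>, and \<open>u\<close> vanishes by backward uniqueness (Gronwall) on each \<open>[e, R]\<close>, \<open>e > 0\<close>.
\<close>

section \<open>Two one-variable tools: powers of the absolute value and a backward Gronwall
  argument\<close>

text \<open>At 0 the difference quotient is bounded by |h|^(p-1), which tends to 0 because p > 1;
  elsewhere the chain rule applies. The derivative is written without \<open>sgn\<close> so that p =
  q + 1 yields the nonlinearity |u|^(q-1) u literally, also at zeros of u.\<close>

lemma DERIV_abs_powr:
  fixes p t :: real
  assumes "p > 1"
  shows "((\<lambda>t. \<bar>t\<bar> powr p) has_real_derivative p * (\<bar>t\<bar> powr (p - 2) * t)) (at t)"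
proof (cases "t = 0")
  case True
  have "((\<lambda>h. \<bar>h\<bar> powr (p - 1)) \<longlongrightarrow> \<bar>0::real\<bar> powr (p - 1)) (at 0)"
    using assms by (intro tendsto_intros) auto
  then have lim: "((\<lambda>h::real. \<bar>h\<bar> powr (p - 1)) \<longlongrightarrow> 0) (at 0)"
    by simp
  have "((\<lambda>h::real. \<bar>h\<bar> powr p / h) \<longlongrightarrow> 0) (at 0)"
  proof (rule Lim_null_comparison[OF _ lim])
    show "\<forall>\<^sub>F h in at 0. norm (\<bar>h\<bar> powr p / h) \<le> \<bar>h\<bar> powr (p - 1)"
      by (auto simp: eventually_at_filter powr_diff abs_divide)
  qed
  then show ?thesis
    using True by (simp add: DERIV_def)
next
  case False
  have abs: "(abs has_real_derivative sgn t) (at t)"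
    using has_derivative_norm[OF False]
    by (simp add: has_field_derivative_def real_norm_def[abs_def] mult_commute_abs)
  have "((\<lambda>t. \<bar>t\<bar> powr p) has_real_derivative p * \<bar>t\<bar> powr (p - 1) * sgn t) (at t)"
    by (rule DERIV_chain2[where f = "\<lambda>z. z powr p", OF has_real_derivative_powr abs])
      (use False in simp)
  moreover have "\<bar>t\<bar> powr (p - 1) * sgn t = \<bar>t\<bar> powr (p - 2) * t"
  proof -
    have "\<bar>t\<bar> powr (p - 1) = \<bar>t\<bar> powr (p - 2) * \<bar>t\<bar>"
      using False powr_add[of "\<bar>t\<bar>" "p - 2" 1] by simp
    then show ?thesis
      by (simp only: mult.assoc abs_mult_sgn)
  qed
  ultimately show ?thesis
    by (simp only: mult.assoc)
qed

text \<open>The integrating factor exp(C x) makes E(x) exp(C x) nondecreasing, so its value at e is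
  at most its value 0 at R.\<close>

lemma backward_gronwall_zero:
  fixes E E' :: "real \<Rightarrow> real"
  assumes "e \<le> R" and cont: "continuous_on {e..R} E"
    and der: "\<And>x. e < x \<Longrightarrow> x < R \<Longrightarrow> (E has_real_derivative E' x) (at x)"
    and ineq: "\<And>x. e < x \<Longrightarrow> x < R \<Longrightarrow> E' x \<ge> - C * E x"
    and "E R = 0" "E e \<ge> 0"
  shows "E e = 0"
proof -
  have "E e * exp (C * e) \<le> E R * exp (C * R)"
  proof (rule DERIV_nonneg_imp_increasing_open[OF \<open>e \<le> R\<close>])
    fix x assume x: "e < x" "x < R"
    have "((\<lambda>x. E x * exp (C * x)) has_real_derivative (E' x + C * E x) * exp (C * x)) (at x)"
      by (rule derivative_eq_intros der[OF x] refl | simp add: algebra_simps)+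
    then show "\<exists>y. ((\<lambda>x. E x * exp (C * x)) has_real_derivative y) (at x) \<and> 0 \<le> y"
      using ineq[OF x] by (intro exI conjI) auto
  next
    show "continuous_on {e..R} (\<lambda>x. E x * exp (C * x))"
      by (intro continuous_intros cont)
  qed
  with assms show ?thesis
    by (simp add: mult_le_0_iff)
qed

section \<open>Interior derivatives, the bound on \<open>lam\<close>, and positivity of a\<close>

lemma C_ivl_DERIV:
  assumes "C_ivl k R f" "j < k" "0 < x" "x < R"
  shows "(ivl_deriv R j f has_real_derivative ivl_deriv R (Suc j) f x) (at x)"
  using C_ivl_has_derivative[of k R f j x] at_within_Icc_at[of 0 x R] assms by simp

lemma C_ivl_continuous_on:
  "C_ivl k R f \<Longrightarrow> j \<le> k \<Longrightarrow> continuous_on {0..R} (ivl_deriv R j f)"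
  by (simp add: C_ivl_def)

lemma C_ivl_mono: "C_ivl k R f \<Longrightarrow> j \<le> k \<Longrightarrow> C_ivl j R f"
  by (simp add: C_ivl_def)

lemma mu_star_le:
  assumes "n > 2" "x \<in> {0<..<R}" "ereal lam \<le> mu_star a n R"
  shows "lam \<le> (n - 2) / 4 * ((n - 1) * (ivl_deriv R 2 a x / a x)
            + ivl_deriv R 3 a x / ivl_deriv R 1 a x)"
proof -
  have "mu_star a n R \<le> ereal ((n - 2) / 4) * ereal ((n - 1) * (ivl_deriv R 2 a x / a x)
            + ivl_deriv R 3 a x / ivl_deriv R 1 a x)"
    unfolding mu_star_def using assms by (intro ereal_mult_left_mono INF_lower) auto
  with assms(3) have "ereal lam \<le> ereal ((n - 2) / 4 * ((n - 1) * (ivl_deriv R 2 a x / a x)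
            + ivl_deriv R 3 a x / ivl_deriv R 1 a x))"
    by (simp only: times_ereal.simps(1) order_trans)
  then show ?thesis by simp
qed

lemma C_ivl_pos:
  assumes "C_ivl k R a" "1 \<le> k" "a 0 = 0" "\<forall>x\<in>{0<..<R}. ivl_deriv R 1 a x > 0"
    and "0 < x" "x \<le> R"
  shows "a x > 0"
proof -
  have "a 0 < a x"
  proof (rule DERIV_pos_imp_increasing_open[OF \<open>0 < x\<close>])
    fix y assume "0 < y" "y < x"
    then show "\<exists>d. (a has_real_derivative d) (at y) \<and> 0 < d"
      using C_ivl_DERIV[of k R a 0 y] assms by auto
  next
    show "continuous_on {0..x} a"
      using C_ivl_continuous_on[of k R a 0] assms by (auto intro: continuous_on_subset)
  qed
  with assms show ?thesis by simp
qed

section \<open>The Pohozaev functional and its derivative\<close>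

text \<open>Product rule for the shape of the functional below, with f, g, F, v, b, c in the roles
  of a^n, a^(n-1), |u|^(q+1)/(q+1), u', a', a''. Keeping them abstract fixes the unsimplified form
  of the derivative, into which the equation is then substituted.\<close>

lemma DERIV_pohozaev_form:
  fixes f g F u v b c :: "real \<Rightarrow> real"
  assumes D: "(f has_real_derivative f') (at x)" "(g has_real_derivative g') (at x)"
        "(F has_real_derivative F') (at x)" "(u has_real_derivative u') (at x)"
        "(v has_real_derivative v') (at x)" "(b has_real_derivative b') (at x)"
        "(c has_real_derivative c') (at x)"
  shows "((\<lambda>x. f x * ((v x)\<^sup>2 / 2 + lam * (u x)\<^sup>2 / 2 + F x) + k * (g x * b x * u x * v x)
        - m * (g x * c x * (u x)\<^sup>2)) has_real_derivative
      f' * ((v x)\<^sup>2 / 2 + lam * (u x)\<^sup>2 / 2 + F x) + f x * (v x * v' + lam * u x * u' + F')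
      + k * (g' * b x * u x * v x + g x * b' * u x * v x + g x * b x * u' * v x + g x * b x * u x * v')
      - m * (g' * c x * (u x)\<^sup>2 + g x * c' * (u x)\<^sup>2 + g x * c x * (2 * u x * u'))) (at x)"
proof -
  have sq: "((\<lambda>x. (h x)\<^sup>2) has_real_derivative 2 * h x * h') (at x)"
    if "(h has_real_derivative h') (at x)" for h h'
    using DERIV_power[OF that, of 2] by (simp add: mult.commute mult.left_commute)
  note deriv = DERIV_diff[OF DERIV_add[OF DERIV_mult[OF D(1)
      DERIV_add[OF DERIV_add[OF DERIV_cdivide[OF sq[OF D(5)]] DERIV_cdivide[OF DERIV_cmult[OF sq[OF D(4)]]]] D(3)]]
      DERIV_cmult[OF DERIV_mult[OF DERIV_mult[OF DERIV_mult[OF D(2,6)] D(4)] D(5)]]]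
    DERIV_cmult[OF DERIV_mult[OF DERIV_mult[OF D(2,7)] sq[OF D(4)]]]]
  show ?thesis
    by (rule DERIV_cong[OF deriv]) (simp add: field_simps)
qed

text \<open>The last summand is a correction: its derivative cancels the term a^(n-1) a'' u u'
  produced by the second summand and otherwise contributes only multiples of u^2. For a(x) = x this
  is the classical Pohozaev functional of radial functions.\<close>

definition pohozaev ::
  "(real \<Rightarrow> real) \<Rightarrow> real \<Rightarrow> real \<Rightarrow> real \<Rightarrow> real \<Rightarrow> (real \<Rightarrow> real) \<Rightarrow> real \<Rightarrow> real" where
  "pohozaev a n R q lam u x =
     a x powr n * ((ivl_deriv R 1 u x)\<^sup>2 / 2 + lam * (u x)\<^sup>2 / 2 + \<bar>u x\<bar> powr (q + 1) / (q + 1))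
     + (n - 2) / 2 * (a x powr (n - 1) * ivl_deriv R 1 a x * u x * ivl_deriv R 1 u x)
     - (n - 2) / 4 * (a x powr (n - 1) * ivl_deriv R 2 a x * (u x)\<^sup>2)"

text \<open>Once u'' is eliminated by the equation, the terms in u u' cancel, those in u'^2 cancel
  because n/2 - (n-1) + (n-2)/2 = 0, and \<open>lam\<close> survives with factor n/2 - (n-2)/2 =
  1.\<close>

lemma pohozaev_derivative:
  assumes n: "n > 2" and q: "q = (n + 2) / (n - 2)"
    and a: "C_ivl 3 R a" and u: "C_ivl 2 R u" and x: "0 < x" "x < R"
    and pos: "a x > 0" "ivl_deriv R 1 a x > 0"
    and eq: "- ivl_deriv R 2 u x - (n - 1) * (ivl_deriv R 1 a x / a x) * ivl_deriv R 1 u x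
        = lam * u x + \<bar>u x\<bar> powr (q - 1) * u x"
  shows "(pohozaev a n R q lam u has_real_derivative
     a x powr (n - 1) * ivl_deriv R 1 a x * (u x)\<^sup>2 *
     (lam - (n - 2) / 4 * ((n - 1) * (ivl_deriv R 2 a x / a x)
            + ivl_deriv R 3 a x / ivl_deriv R 1 a x))) (at x)"
proof -
  let ?a1 = "ivl_deriv R 1 a" and ?a2 = "ivl_deriv R 2 a" and ?a3 = "ivl_deriv R 3 a"
  let ?u1 = "ivl_deriv R 1 u" and ?u2 = "ivl_deriv R 2 u"
  have q1: "q + 1 = 2 * n / (n - 2)" "q + 1 > 1" "q + 1 \<noteq> 0"
    using n unfolding q by (auto simp: field_simps)
  have da: "(a has_real_derivative ?a1 x) (at x)"
    and da1: "(?a1 has_real_derivative ?a2 x) (at x)"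
    and da2: "(?a2 has_real_derivative ?a3 x) (at x)"
    using C_ivl_DERIV[OF a _ x, of 0] C_ivl_DERIV[OF a _ x, of 1] C_ivl_DERIV[OF a _ x, of 2]
    by (simp_all add: numeral_2_eq_2 numeral_3_eq_3)
  have du: "(u has_real_derivative ?u1 x) (at x)"
    and du1: "(?u1 has_real_derivative ?u2 x) (at x)"
    using C_ivl_DERIV[OF u _ x, of 0] C_ivl_DERIV[OF u _ x, of 1]
    by (simp_all add: numeral_2_eq_2)
  define A where "A = a x powr (n - 1)"
  have An: "a x powr n = A * a x" and An2: "a x powr (n - 2) = A / a x"
    using pos powr_add[of "a x" "n - 1" 1] powr_diff[of "a x" "n - 1" 1] by (simp_all add: A_def)
  have dpn: "((\<lambda>x. a x powr n) has_real_derivative n * A * ?a1 x) (at x)"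
    using DERIV_chain2[OF has_real_derivative_powr[OF pos(1)] da, of n] by (simp add: A_def)
  have dpn1: "((\<lambda>x. a x powr (n - 1)) has_real_derivative (n - 1) * (A / a x) * ?a1 x) (at x)"
    using DERIV_chain2[OF has_real_derivative_powr[OF pos(1)] da, of "n - 1"]
    by (simp add: An2[symmetric])
  define w where "w = \<bar>u x\<bar> powr (q - 1)"
  have w: "\<bar>u x\<bar> powr (q + 1) = w * (u x)\<^sup>2"
  proof (cases "u x = 0")
    case False
    then have "\<bar>u x\<bar> powr (q + 1) = w * \<bar>u x\<bar> powr 2"
      using powr_add[of "\<bar>u x\<bar>" "q - 1" 2] by (simp add: w_def add.commute)
    with False show ?thesis by simp
  qed (use q1 in simp)
  have dF: "((\<lambda>x. \<bar>u x\<bar> powr (q + 1)) has_real_derivative (q + 1) * (w * u x) * ?u1 x) (at x)"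
    using DERIV_chain2[OF DERIV_abs_powr[OF q1(2)] du] by (simp add: w_def)
  have dF': "((\<lambda>x. \<bar>u x\<bar> powr (q + 1) / (q + 1)) has_real_derivative w * u x * ?u1 x) (at x)"
    using DERIV_cdivide[OF dF, of "q + 1"] q1(3) by (simp add: mult.assoc)
  have u2: "?u2 x = - ((n - 1) * (?a1 x / a x) * ?u1 x) - lam * u x - w * u x"
    using eq unfolding w_def by linarith
  \<comment> \<open>Criticality enters here: 1/(q+1) = (n-2)/(2n), so n times the potential term
    balances the contribution -(n-2)/2 w u^2 of the second multiplier.\<close>
  have Fx: "\<bar>u x\<bar> powr (q + 1) / (q + 1) = w * (u x)\<^sup>2 * (n - 2) / (2 * n)"
    using n unfolding w unfolding q1(1) by simp
  have "(pohozaev a n R q lam u has_real_derivative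
     n * A * ?a1 x * ((?u1 x)\<^sup>2 / 2 + lam * (u x)\<^sup>2 / 2 + \<bar>u x\<bar> powr (q + 1) / (q + 1))
     + a x powr n * (?u1 x * ?u2 x + lam * u x * ?u1 x + w * u x * ?u1 x)
     + (n - 2) / 2 * ((n - 1) * (A / a x) * ?a1 x * ?a1 x * u x * ?u1 x
         + A * ?a2 x * u x * ?u1 x + A * ?a1 x * ?u1 x * ?u1 x + A * ?a1 x * u x * ?u2 x)
     - (n - 2) / 4 * ((n - 1) * (A / a x) * ?a1 x * ?a2 x * (u x)\<^sup>2
         + A * ?a3 x * (u x)\<^sup>2 + A * ?a2 x * (2 * u x * ?u1 x))) (at x)"
    using DERIV_pohozaev_form[OF dpn dpn1 dF' du du1 da1 da2,
        of lam "(n - 2) / 2" "(n - 2) / 4"]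
    unfolding pohozaev_def[abs_def] A_def[symmetric] .
  moreover have "n * A * ?a1 x * ((?u1 x)\<^sup>2 / 2 + lam * (u x)\<^sup>2 / 2 + \<bar>u x\<bar> powr (q + 1) / (q + 1))
     + a x powr n * (?u1 x * ?u2 x + lam * u x * ?u1 x + w * u x * ?u1 x)
     + (n - 2) / 2 * ((n - 1) * (A / a x) * ?a1 x * ?a1 x * u x * ?u1 x
         + A * ?a2 x * u x * ?u1 x + A * ?a1 x * ?u1 x * ?u1 x + A * ?a1 x * u x * ?u2 x)
     - (n - 2) / 4 * ((n - 1) * (A / a x) * ?a1 x * ?a2 x * (u x)\<^sup>2
         + A * ?a3 x * (u x)\<^sup>2 + A * ?a2 x * (2 * u x * ?u1 x))
    = A * ?a1 x * (u x)\<^sup>2 * (lam - (n - 2) / 4 * ((n - 1) * (?a2 x / a x) + ?a3 x / ?a1 x))"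
  proof -
    \<comment> \<open>In terms of these quotients no division by a function value is left, and the
      claim becomes a polynomial identity with rational coefficients.\<close>
    define B r M N where "B = A / a x" and "r = ?a1 x / a x" and "M = ?a2 x / a x"
      and "N = ?a3 x / ?a1 x"
    have A: "A = B * a x" and a1: "?a1 x = r * a x" and a2: "?a2 x = M * a x"
      and a3: "?a3 x = N * (r * a x)"
      using pos by (simp_all add: B_def r_def M_def N_def)
    have nF: "n * (\<bar>u x\<bar> powr (q + 1) / (q + 1)) = w * (u x)\<^sup>2 * (n - 2) / 2"
      using n unfolding Fx by simp
    have split: "n * A * ?a1 x * ((?u1 x)\<^sup>2 / 2 + lam * (u x)\<^sup>2 / 2 + \<bar>u x\<bar> powr (q + 1) / (q + 1))
      = A * ?a1 x * (n * ((?u1 x)\<^sup>2 / 2 + lam * (u x)\<^sup>2 / 2) + w * (u x)\<^sup>2 * (n - 2) / 2)"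
      unfolding nF[symmetric] by (simp add: algebra_simps)
    show ?thesis
      unfolding split An u2 B_def[symmetric] r_def[symmetric] M_def[symmetric] N_def[symmetric]
      unfolding a1 a2 a3 A
      by (simp add: field_simps power2_eq_square)
  qed
  ultimately show ?thesis
    by (simp add: A_def)
qed

text \<open>The derivative formula holds only inside the interval, since a may vanish at 0;
  continuity carries monotonicity to the end points. Powers with base 0 stay continuous because n, n
  - 1 and q + 1 are positive.\<close>

lemma continuous_on_pohozaev:
  assumes "n > 1" "q > 0" "C_ivl 3 R a" "C_ivl 2 R u" "\<forall>x\<in>{0..R}. a x \<ge> 0"
  shows "continuous_on {0..R} (pohozaev a n R q lam u)"
proof -
  have a: "continuous_on {0..R} a" "continuous_on {0..R} (ivl_deriv R 1 a)"
      "continuous_on {0..R} (ivl_deriv R 2 a)"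
    and u: "continuous_on {0..R} u" "continuous_on {0..R} (ivl_deriv R 1 u)"
    using C_ivl_continuous_on[OF assms(3), of 0] C_ivl_continuous_on[OF assms(3), of 1]
      C_ivl_continuous_on[OF assms(3), of 2] C_ivl_continuous_on[OF assms(4), of 0]
      C_ivl_continuous_on[OF assms(4), of 1] by simp_all
  have p: "continuous_on {0..R} (\<lambda>x. a x powr n)" "continuous_on {0..R} (\<lambda>x. a x powr (n - 1))"
    "continuous_on {0..R} (\<lambda>x. \<bar>u x\<bar> powr (q + 1))"
    using assms by (auto intro!: continuous_on_powr' continuous_on_const continuous_on_rabs a u)
  show ?thesis
    unfolding pohozaev_def[abs_def]
    by (intro continuous_on_add continuous_on_diff continuous_on_mult continuous_on_divide
        continuous_on_power continuous_on_const a u p) (use assms in auto)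
qed

section \<open>Backward uniqueness from vanishing Cauchy data at R\<close>

lemma continuous_on_Icc_abs_bounded:
  fixes f :: "real \<Rightarrow> real"
  assumes "continuous_on {s..t} f"
  shows "\<exists>B. \<forall>x\<in>{s..t}. \<bar>f x\<bar> \<le> B"
  using compact_imp_bounded[OF compact_continuous_image[OF assms compact_Icc]]
  by (auto simp: bounded_iff)

text \<open>Away from 0 the coefficient a'/a is bounded, and |u|^(q-1), continuous as q > 1, can be
  treated as a bounded coefficient too. The equation is then linear with bounded coefficients, and
  Gronwall applies to u^2 + u'^2.\<close>

lemma solution_zero_if_zero_Cauchy_data:
  assumes n: "n > 1" and q: "q > 1" and a: "C_ivl 1 R a"
    and apos: "\<And>x. 0 < x \<Longrightarrow> x \<le> R \<Longrightarrow> a x > 0"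
    and sol: "is_solution a n R q lam u" and u1R: "ivl_deriv R 1 u R = 0"
    and e: "0 < e" "e \<le> R"
  shows "u e = 0"
proof -
  let ?a1 = "ivl_deriv R 1 a" and ?u1 = "ivl_deriv R 1 u" and ?u2 = "ivl_deriv R 2 u"
  have u: "C_ivl 2 R u" and uR: "u R = 0" using sol by (auto simp: is_solution_def)
  have sub: "{e..R} \<subseteq> {0..R}" using e by auto
  have ca: "continuous_on {e..R} a" "continuous_on {e..R} ?a1"
    and cu: "continuous_on {e..R} u" "continuous_on {e..R} ?u1"
    using C_ivl_continuous_on[OF a, of 0] C_ivl_continuous_on[OF a, of 1]
      C_ivl_continuous_on[OF u, of 0] C_ivl_continuous_on[OF u, of 1]
    by (auto intro: continuous_on_subset[OF _ sub])
  let ?b = "\<lambda>x. (n - 1) * (?a1 x / a x)"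
  have anz: "\<forall>x\<in>{e..R}. a x \<noteq> 0"
    using apos e by (metis atLeastAtMost_iff less_irrefl less_le_trans)
  have cb: "continuous_on {e..R} ?b"
    by (intro continuous_intros ca anz)
  have cw: "continuous_on {e..R} (\<lambda>x. \<bar>u x\<bar> powr (q - 1))"
    using q by (intro continuous_on_powr' continuous_intros cu) auto
  obtain B where B: "\<And>x. x \<in> {e..R} \<Longrightarrow> \<bar>?b x\<bar> \<le> B"
    using continuous_on_Icc_abs_bounded[OF cb] by blast
  obtain W where W: "\<And>x. x \<in> {e..R} \<Longrightarrow> \<bar>\<bar>u x\<bar> powr (q - 1)\<bar> \<le> W"
    using continuous_on_Icc_abs_bounded[OF cw] by blast
  \<comment> \<open>The derivative of u^2 + u'^2 is 2 c u u' - 2 b u'^2 with c = 1 -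
    \<open>lam\<close> - |u|^(q-1): the summand 2 B controls the damping term, the rest bounds
    |c|.\<close>
  define C where "C = 1 + 2 * B + \<bar>lam\<bar> + W"
  have "(u e)\<^sup>2 + (?u1 e)\<^sup>2 = 0"
  proof (rule backward_gronwall_zero[where E = "\<lambda>x. (u x)\<^sup>2 + (?u1 x)\<^sup>2"
        and E' = "\<lambda>x. 2 * u x * ?u1 x + 2 * ?u1 x * ?u2 x" and C = C, OF e(2)])
    show "continuous_on {e..R} (\<lambda>x. (u x)\<^sup>2 + (?u1 x)\<^sup>2)"
      by (intro continuous_intros cu)
  next
    fix x assume x: "e < x" "x < R"
    then have x': "0 < x" "x < R" using e by auto
    have du: "(u has_real_derivative ?u1 x) (at x)"
      and du1: "(?u1 has_real_derivative ?u2 x) (at x)"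
      using C_ivl_DERIV[OF u _ x', of 0] C_ivl_DERIV[OF u _ x', of 1]
      by (simp_all add: numeral_2_eq_2)
    show "((\<lambda>x. (u x)\<^sup>2 + (?u1 x)\<^sup>2) has_real_derivative
        2 * u x * ?u1 x + 2 * ?u1 x * ?u2 x) (at x)"
      by (rule derivative_eq_intros du du1 refl | simp)+
    define b where "b = ?b x"
    define c where "c = 1 - lam - \<bar>u x\<bar> powr (q - 1)"
    have u2: "?u2 x = - b * ?u1 x - lam * u x - \<bar>u x\<bar> powr (q - 1) * u x"
      using bspec[OF conjunct1[OF conjunct2[OF sol[unfolded is_solution_def]]], of x] x'
      by (simp add: b_def)
    have "\<bar>b\<bar> \<le> B" and "\<bar>\<bar>u x\<bar> powr (q - 1)\<bar> \<le> W"
      unfolding b_def using x by (intro B W; simp)+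
    then have b: "b \<le> B" "0 \<le> B" and c: "\<bar>c\<bar> \<le> 1 + \<bar>lam\<bar> + W"
      unfolding c_def by linarith+
    define K S T where "K = 1 + \<bar>lam\<bar> + W" and "S = (u x)\<^sup>2 + (?u1 x)\<^sup>2"
      and "T = 2 * u x * ?u1 x"
    have "\<bar>T\<bar> \<le> S"
      using sum_squares_bound[of "\<bar>u x\<bar>" "\<bar>?u1 x\<bar>"] by (simp add: S_def T_def abs_mult)
    then have "\<bar>c * T\<bar> \<le> K * S"
      unfolding abs_mult using c by (intro mult_mono) (auto simp: K_def)
    then have "- (K * S) \<le> c * T"
      by linarith
    moreover have "b * (?u1 x)\<^sup>2 \<le> B * S"
      using b by (intro mult_mono) (auto simp: S_def)
    moreover have "2 * u x * ?u1 x + 2 * ?u1 x * ?u2 x = c * T - 2 * (b * (?u1 x)\<^sup>2)"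
      unfolding u2 c_def T_def by (simp add: algebra_simps power2_eq_square)
    moreover have "- C * S = - (K * S) - 2 * (B * S)"
      by (simp add: C_def K_def algebra_simps)
    ultimately show "- C * ((u x)\<^sup>2 + (?u1 x)\<^sup>2) \<le> 2 * u x * ?u1 x + 2 * ?u1 x * ?u2 x"
      unfolding S_def[symmetric] by linarith
  qed (simp_all add: uR u1R[simplified])
  then show ?thesis
    by (simp add: sum_power2_eq_zero_iff)
qed

theorem theorem1p1:
  fixes n R q lam :: real and a :: "real \<Rightarrow> real"
  assumes "n > 2"
    and "R > 0"
    and "q = (n + 2) / (n - 2)"
    and "C_ivl 3 R a"
    and "a 0 = 0"
    and "\<forall>x\<in>{0<..<R}. ivl_deriv R 1 a x > 0"
    and "\<exists>\<omega>\<ge>0. \<forall>x\<in>{0<..<R}. ivl_deriv R 2 a x \<ge> \<omega> * a x"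
    and "ereal lam \<le> mu_star a n R"
  shows "\<not> (\<exists>u. is_solution a n R q lam u \<and> (\<exists>x\<in>{0..R}. u x \<noteq> 0))"
proof -
  have "\<forall>x\<in>{0..R}. u x = 0" if sol: "is_solution a n R q lam u" for u
  proof -
    let ?P = "pohozaev a n R q lam u"
    have u: "C_ivl 2 R u" and uR: "u R = 0" using sol by (auto simp: is_solution_def)
    have q1: "q > 1" using assms(1) unfolding assms(3) by (simp add: field_simps)
    have apos: "a x > 0" if "0 < x" "x \<le> R" for x
      using C_ivl_pos[OF assms(4) _ assms(5,6) that] by simp
    have "?P R \<le> ?P 0"
    proof (rule DERIV_nonpos_imp_decreasing_open[where f = ?P and a = 0 and b = R])
      fix x assume x: "0 < x" "x < R"
      have a1: "ivl_deriv R 1 a x > 0" using assms(6) x by simp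
      have ax: "a x > 0" using apos x by simp
      have "(?P has_real_derivative a x powr (n - 1) * ivl_deriv R 1 a x * (u x)\<^sup>2 *
          (lam - (n - 2) / 4 * ((n - 1) * (ivl_deriv R 2 a x / a x)
            + ivl_deriv R 3 a x / ivl_deriv R 1 a x))) (at x)"
        using sol x
        by (intro pohozaev_derivative assms u ax a1) (auto simp: is_solution_def)
      moreover have "a x powr (n - 1) * ivl_deriv R 1 a x * (u x)\<^sup>2 *
          (lam - (n - 2) / 4 * ((n - 1) * (ivl_deriv R 2 a x / a x)
            + ivl_deriv R 3 a x / ivl_deriv R 1 a x)) \<le> 0"
        using mu_star_le[OF assms(1) _ assms(8), of x] x a1
        by (intro mult_nonneg_nonpos mult_nonneg_nonneg) auto
      ultimately show "\<exists>y. (?P has_real_derivative y) (at x) \<and> y \<le> 0"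
        by blast
    next
      have "\<forall>x\<in>{0..R}. a x \<ge> 0"
        using apos assms(5) by (metis atLeastAtMost_iff order_le_less)
      then show "continuous_on {0..R} ?P"
        using assms q1 u by (intro continuous_on_pohozaev) auto
    qed (use assms in simp)
    \<comment> \<open>Every summand carries a power of a(0) = 0, and \<open>0 powr _\<close> is
      0.\<close>
    moreover have "?P 0 = 0"
      using assms by (simp add: pohozaev_def)
    moreover have "?P R = a R powr n * (ivl_deriv R 1 u R)\<^sup>2 / 2"
      using uR q1 by (simp add: pohozaev_def)
    moreover have "a R powr n > 0"
      using apos[of R] assms(2) by simp
    \<comment> \<open>A positive multiple of u'(R)^2 is at most 0.\<close>
    ultimately have "ivl_deriv R 1 u R = 0"
      by (simp add: mult_le_0_iff)
    moreover have "C_ivl 1 R a"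
      using C_ivl_mono[OF assms(4)] by simp
    ultimately have zero: "u x = 0" if "0 < x" "x \<le> R" for x
      using solution_zero_if_zero_Cauchy_data[OF _ q1 _ apos sol _ that] assms(1) by simp
    \<comment> \<open>Backward uniqueness stops short of the singular point 0; there u vanishes by
      continuity.\<close>
    have "u x = 0" if "x \<in> {0..R}" for x
    proof (rule continuous_constant_on_closure[where f = u and a = 0 and S = "{0<..R}"])
      show "continuous_on (closure {0<..R}) u"
        using C_ivl_continuous_on[OF u, of 0] assms(2) by simp
    qed (use zero that assms(2) in auto)
    then show ?thesis by blast
  qed
  then show ?thesis by blast
qed

end
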